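(* Let $\delta>0$ be an integer. The weight of edges in the weighted graphs $\mathcal{W}_n$ follows a power-law distribution with exponent $\gamma_w=1+\frac{\ln(\delta+4)}{\ln(\delta+1)}$.
   Context: The weight distribution $P(w)$ of a weighted graph is the probability that a randomly chosen edge has weight $w$; it is said to be a power law with exponent $\gamma$ if $P(w)\sim w^{-\gamma}$, in which case the cumulative distribution (probability that an edge has weight greater than or equal to $w$) scales as $P_{\rm cum}(w)\sim w^{-(\gamma-1)}$. The strength of a vertex $i$ in a weighted graph is $s_i=\sum_j w_{ij}$, the sum of the weights of its incident edges. The weighted graphs $\mathcal{W}_n$ ($n\ge 0$) are defined recursively for a fixed integer $\delta>0$. $\mathcal{W}_0$ is a triangle whose three edges have weight $1$. For $n\ge1$, $\mathcal{W}_n$ is obtained from $\mathcal{W}_{n-1}$ as follows: (I) for each vertex $i$ of $\mathcal{W}_{n-1}$, of strength $s_i$ in $\mathcal{W}_{n-1}$ (always an even integer), take $s_i/2$ new disjoint copies of $\mathcal{K}_2$ (two vertices joined by an edge of weight $1$) and join both vertices of each copy to $i$ by edges of weight $1$; (II) increase the weight $w$ of every edge that already belonged to $\mathcal{W}_{n-1}$ by $\delta w$, i.e. multiply it by $1+\delta$.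
   Formalization: P(w) is taken per unit of weight (probability of w divided by the gap to the next attained weight), since the bare probabilities scale as w^{-(γ-1)}; "~" means two-sided bounds with constants uniform in n and w, for both P and P_cum. *)

theory Defs
  imports "HOL-Probability.Probability" "HOL-Library.Landau_Symbols"
begin

text \<open>Finite weighted simple graphs. Edges are two-element sets of vertices; the value of
  \<open>weight\<close> matters only on \<open>edges\<close>.\<close>

record 'v wgraph =
  verts :: "'v set"
  edges :: "'v set set"
  weight :: "'v set \<Rightarrow> nat"

definition strength :: "'v wgraph \<Rightarrow> 'v \<Rightarrow> nat" where
  "strength G i = (\<Sum>j\<in>{j \<in> verts G. {i, j} \<in> edges G}. weight G {i, j})"

text \<open>\<open>New n i k b\<close> is one of the two endpoints (selected by \<open>b\<close>) of the \<open>k\<close>-th copy of \<open>K\<^sub>2\<close> that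
  is attached to the vertex \<open>i\<close> when the \<open>n\<close>-th graph is formed. The step number \<open>n\<close> keeps the
  copies attached to \<open>i\<close> at different steps disjoint.\<close>

datatype vertex = Corner nat | New nat vertex nat bool

text \<open>The strength of a vertex is always even in the graphs considered here, so that the
  truncating division below is exact.\<close>

definition step :: "nat \<Rightarrow> nat \<Rightarrow> vertex wgraph \<Rightarrow> vertex wgraph" where
  "step \<delta> n G = \<lparr>
     verts = verts G \<union> {New n i k b | i k b. i \<in> verts G \<and> k < strength G i div 2},
     edges = edges G
       \<union> {{New n i k False, New n i k True} | i k. i \<in> verts G \<and> k < strength G i div 2}
       \<union> {{i, New n i k b} | i k b. i \<in> verts G \<and> k < strength G i div 2},
     weight = (\<lambda>e. if e \<in> edges G then (1 + \<delta>) * weight G e else 1) \<rparr>"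

primrec W :: "nat \<Rightarrow> nat \<Rightarrow> vertex wgraph" where
  "W \<delta> 0 = \<lparr> verts = {Corner 0, Corner 1, Corner 2},
             edges = {{Corner 0, Corner 1}, {Corner 1, Corner 2}, {Corner 0, Corner 2}},
             weight = (\<lambda>_. 1) \<rparr>"
| "W \<delta> (Suc n) = step \<delta> (Suc n) (W \<delta> n)"

definition weight_pmf :: "'v wgraph \<Rightarrow> real pmf" where
  "weight_pmf G = map_pmf (\<lambda>e. real (weight G e)) (pmf_of_set (edges G))"

definition cumulative :: "real pmf \<Rightarrow> real \<Rightarrow> real" where
  "cumulative p w = measure_pmf.prob p {w..}"

text \<open>The law \<open>P(w) \<sim> w\<^sup>-\<^sup>\<gamma>\<close>, whose cumulative form is \<open>w\<^sup>-\<^sup>(\<^sup>\<gamma>\<^sup>-\<^sup>1\<^sup>)\<close>, refers to probability per unit of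
  weight. For a discrete distribution the probability of an attained value \<open>w\<close> is therefore
  divided by the distance from \<open>w\<close> to the next attained value: when the attained values are spaced
  geometrically, the bare point masses scale like the cumulative distribution, with exponent
  \<open>\<gamma> - 1\<close>.\<close>

definition prob_density :: "real pmf \<Rightarrow> real \<Rightarrow> real" where
  "prob_density p w = pmf p w / (Min {v \<in> set_pmf p. w < v} - w)"

text \<open>A sequence of finitely supported distributions follows a power law with exponent \<open>\<gamma>\<close> if its
  range of values grows without bound and, over the whole range, density and cumulative
  distribution are of exact order \<open>w\<^sup>-\<^sup>\<gamma>\<close> and \<open>w\<^sup>-\<^sup>(\<^sup>\<gamma>\<^sup>-\<^sup>1\<^sup>)\<close>. Membership in \<open>\<Theta>\<close> with respect to a principal
  filter is a two-sided bound valid on the entire set of pairs \<open>(n, w)\<close>, so the constants depend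
  neither on \<open>n\<close> nor on \<open>w\<close>. The largest value has no successor and hence no density.\<close>

definition power_law :: "(nat \<Rightarrow> real pmf) \<Rightarrow> real \<Rightarrow> bool" where
  "power_law p \<gamma> \<longleftrightarrow>
     filterlim (\<lambda>n. Max (set_pmf (p n))) at_top sequentially \<and>
     (\<lambda>(n, w). prob_density (p n) w)
       \<in> \<Theta>[principal {(n, w). w \<in> set_pmf (p n) \<and> w < Max (set_pmf (p n))}](\<lambda>(n, w). w powr - \<gamma>) \<and>
     (\<lambda>(n, w). cumulative (p n) w)
       \<in> \<Theta>[principal {(n, w). Min (set_pmf (p n)) \<le> w \<and> w \<le> Max (set_pmf (p n))}](\<lambda>(n, w). w powr - (\<gamma> - 1))"

end

theory Submission imports Defs begin

text \<open>A step multiplies the strength of every old vertex by \<open>\<delta> + 2\<close> and gives every new vertex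
  strength \<open>2\<close>; hence the sum of all strengths grows by the factor \<open>q = \<delta> + 4\<close> and the number of
  edges of \<open>W\<^sub>n\<close> is of order \<open>q\<^sup>n\<close>. Since an edge has weight \<open>(1 + \<delta>)\<^sup>m\<close> when it is \<open>m\<close> steps old, the
  edges of \<open>W\<^sub>n\<close> of weight at least \<open>w = (1 + \<delta>)\<^sup>k\<close> are those of \<open>W\<^bsub>n-k\<^esub>\<close>, a fraction of order
  \<open>q\<^sup>-\<^sup>k\<close>. With \<open>\<alpha> = ln q / ln (1 + \<delta>)\<close> this is \<open>w\<^sup>-\<^sup>\<alpha>\<close>. The edges of weight exactly \<open>w\<close> form a fraction
  of the same order, and the gap to the next weight is \<open>\<delta> w\<close>, so the density is of order
  \<open>w\<^sup>-\<^sup>(\<^sup>1\<^sup>+\<^sup>\<alpha>\<^sup>)\<close>.\<close>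

section \<open>One step of the construction, for an arbitrary graph satisfying the invariants of the
  recursion\<close>

primrec stage :: "vertex \<Rightarrow> nat" where
  "stage (Corner c) = 0"
| "stage (New n i k b) = n"

text \<open>The invariants carried through the recursion. \<open>n\<close> is the number of the step
  about to be made: since old stages are below \<open>n\<close>, every \<open>New n i k b\<close> is
  fresh, and since edges stay inside \<open>verts G\<close>, so is every edge with such an endpoint.
  Evenness makes the halving of strengths exact.\<close>

locale stage_bounded_graph =
  fixes G :: "vertex wgraph" and n :: nat and \<delta> :: nat
  assumes finite_verts: "finite (verts G)"
    and edge_subset: "e \<in> edges G \<Longrightarrow> e \<subseteq> verts G"
    and stage_less: "v \<in> verts G \<Longrightarrow> stage v < n"
    and even_strength: "v \<in> verts G \<Longrightarrow> even (strength G v)"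
begin

abbreviation G' :: "vertex wgraph" where "G' \<equiv> step \<delta> n G"

text \<open>Index set of the attached copies of \<open>K\<^sub>2\<close>. Writing the new vertices
  and edges as images of it reduces counting them to injectivity of the parametrizations.\<close>

definition copies :: "(vertex \<times> nat) set" where
  "copies = (SIGMA i:verts G. {..<strength G i div 2})"

definition new_vertex :: "(vertex \<times> nat) \<times> bool \<Rightarrow> vertex" where
  "new_vertex = (\<lambda>((i, k), b). New n i k b)"

definition base_edge :: "vertex \<times> nat \<Rightarrow> vertex set" where
  "base_edge = (\<lambda>(i, k). {New n i k False, New n i k True})"

definition spoke :: "(vertex \<times> nat) \<times> bool \<Rightarrow> vertex set" where
  "spoke = (\<lambda>((i, k), b). {i, New n i k b})"

definition new_edges :: "vertex set set" where
  "new_edges = base_edge ` copies \<union> spoke ` (copies \<times> UNIV)"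

lemma verts_step: "verts G' = verts G \<union> new_vertex ` (copies \<times> UNIV)"
  by (force simp: step_def copies_def new_vertex_def image_iff)

lemma edges_step: "edges G' = edges G \<union> new_edges"
proof -
  have "base_edge ` copies = {{New n i k False, New n i k True} | i k. i \<in> verts G \<and> k < strength G i div 2}"
    unfolding image_def base_edge_def copies_def by auto
  moreover have "spoke ` (copies \<times> UNIV) = {{i, New n i k b} | i k b. i \<in> verts G \<and> k < strength G i div 2}"
    unfolding image_def spoke_def copies_def by auto
  ultimately show ?thesis by (simp add: step_def new_edges_def Un_assoc)
qed

lemma weight_step: "weight G' e = (if e \<in> edges G then (1 + \<delta>) * weight G e else 1)"
  by (simp add: step_def)

lemma New_notin: "New n i k b \<notin> verts G"
  using stage_less by fastforce

lemma new_edge_notin: "e \<in> new_edges \<Longrightarrow> e \<notin> edges G"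
  using edge_subset New_notin by (fastforce simp: new_edges_def base_edge_def spoke_def)

lemma finite_edges: "finite (edges G)"
  using finite_verts edge_subset by (auto intro: finite_subset[of _ "Pow (verts G)"])

lemma finite_copies: "finite copies"
  by (simp add: copies_def finite_verts)

lemma finite_new_edges: "finite new_edges"
  by (simp add: new_edges_def finite_copies)

lemma card_copies: "2 * card copies = (\<Sum>i\<in>verts G. strength G i)"
proof -
  have "card copies = (\<Sum>i\<in>verts G. strength G i div 2)"
    by (simp add: copies_def finite_verts)
  then show ?thesis
    using even_strength by (simp add: sum_distrib_left)
qed

lemma inj_new_vertex: "inj_on new_vertex A"
  by (auto simp: inj_on_def new_vertex_def)

lemma new_vertex_disjoint: "verts G \<inter> new_vertex ` A = {}"
  using New_notin by (auto simp: new_vertex_def)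

text \<open>Each copy brings one base edge and two spokes, and there are half as many copies as the
  total strength. No two of these edges coincide: a spoke has exactly one old endpoint, a base edge
  has none.\<close>

lemma card_new_edges: "2 * card new_edges = 3 * (\<Sum>i\<in>verts G. strength G i)"
proof -
  have base: "inj_on base_edge copies"
    by (auto simp: inj_on_def base_edge_def doubleton_eq_iff)
  have spoke: "inj_on spoke (copies \<times> UNIV)"
    using New_notin by (fastforce simp: inj_on_def spoke_def doubleton_eq_iff copies_def)
  have "base_edge ` copies \<inter> spoke ` (copies \<times> UNIV) = {}"
    using New_notin by (fastforce simp: base_edge_def spoke_def doubleton_eq_iff copies_def)
  then have "card new_edges = card copies + card (copies \<times> (UNIV :: bool set))"
    unfolding new_edges_def
    using base spoke by (simp add: card_Un_disjoint finite_copies card_image)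
  then have "card new_edges = 3 * card copies"
    by (simp add: card_cartesian_product)
  then show ?thesis using card_copies by simp
qed

text \<open>The reweighted old edges at \<open>i\<close> contribute \<open>1 + \<delta>\<close>
  times the old strength; the two spokes from each of the \<open>strength G i div 2\<close> copies
  add the old strength once more.\<close>

lemma strength_step_old:
  assumes i: "i \<in> verts G"
  shows "strength G' i = (\<delta> + 2) * strength G i"
proof -
  let ?A = "{j \<in> verts G. {i, j} \<in> edges G}"
  let ?B = "(\<lambda>(k, b). New n i k b) ` ({..<strength G i div 2} \<times> (UNIV :: bool set))"
  have nb: "{j \<in> verts G'. {i, j} \<in> edges G'} = ?A \<union> ?B" (is "?L = _")
  proof (intro equalityI subsetI)
    fix j assume "j \<in> ?L"
    then have "{i, j} \<in> edges G \<or> {i, j} \<in> new_edges" by (simp add: edges_step)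
    then show "j \<in> ?A \<union> ?B"
    proof
      assume "{i, j} \<in> edges G"
      then show ?thesis using edge_subset by blast
    next
      assume "{i, j} \<in> new_edges"
      then obtain k b where "(i, k) \<in> copies" "j = New n i k b"
        using i New_notin
        by (auto simp: new_edges_def base_edge_def spoke_def copies_def doubleton_eq_iff)
      then show ?thesis by (auto simp: copies_def)
    qed
  next
    fix j assume "j \<in> ?A \<union> ?B"
    then show "j \<in> ?L"
    proof
      assume "j \<in> ?A"
      then show ?thesis by (simp add: verts_step edges_step)
    next
      assume "j \<in> ?B"
      then obtain k b where k: "(i, k) \<in> copies" and j: "j = New n i k b"
        using i by (auto simp: copies_def)
      have "{i, j} = spoke ((i, k), b)" "j = new_vertex ((i, k), b)"
        by (simp_all add: spoke_def new_vertex_def j)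
      then show ?thesis using k by (auto simp: verts_step edges_step new_edges_def)
    qed
  qed
  have inj: "inj_on (\<lambda>(k, b). New n i k b) ({..<strength G i div 2} \<times> (UNIV :: bool set))"
    by (auto simp: inj_on_def)
  have notin: "{i, New n i k b} \<notin> edges G" for k b
    using edge_subset New_notin by blast
  have "strength G' i = (\<Sum>j\<in>?A. weight G' {i, j}) + (\<Sum>j\<in>?B. weight G' {i, j})"
    unfolding strength_def nb using New_notin finite_verts
    by (intro sum.union_disjoint) auto
  also have "(\<Sum>j\<in>?A. weight G' {i, j}) = (1 + \<delta>) * strength G i"
    by (simp add: strength_def weight_step sum_distrib_left)
  also have "(\<Sum>j\<in>?B. weight G' {i, j}) = (\<Sum>j\<in>?B. 1)"
    using notin by (intro sum.cong) (auto simp: weight_step)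
  also have "\<dots> = 2 * (strength G i div 2)"
    by (simp add: card_image[OF inj] card_cartesian_product)
  also have "\<dots> = strength G i"
    using even_strength[OF i] by simp
  finally show ?thesis by (simp add: algebra_simps)
qed

lemma strength_step_new:
  assumes "x \<in> copies \<times> UNIV"
  shows "strength G' (new_vertex x) = 2"
proof -
  obtain i k b where x: "x = ((i, k), b)" by (metis prod.exhaust)
  then have ik: "(i, k) \<in> copies" and i: "i \<in> verts G" 
    using assms by (auto simp: copies_def)
  let ?v = "New n i k b"
  have notin: "{?v, j} \<notin> edges G" for j
    using edge_subset New_notin by blast
  \<comment> \<open>Guarantees that the two neighbours found below, the anchor and the twin in the
    same copy, are distinct, so that their weights 1 add up to 2.\<close>
  have ne: "i \<noteq> New n i' k' b'" for i' k' b' using i New_notin by blast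
  have "{j \<in> verts G'. {?v, j} \<in> edges G'} = {i, New n i k (\<not> b)}" (is "?L = _")
  proof (intro equalityI subsetI)
    fix j assume "j \<in> ?L"
    then have "{?v, j} \<in> new_edges" using notin by (simp add: edges_step)
    then show "j \<in> {i, New n i k (\<not> b)}"
      using New_notin
      by (fastforce simp: new_edges_def base_edge_def spoke_def copies_def doubleton_eq_iff)
  next
    fix j assume "j \<in> {i, New n i k (\<not> b)}"
    then consider "j = i" | "j = New n i k (\<not> b)" by blast
    then show "j \<in> ?L"
    proof cases
      case 1
      have "{?v, i} = spoke ((i, k), b)" by (auto simp: spoke_def)
      then show ?thesis using 1 i ik by (auto simp: verts_step edges_step new_edges_def)
    next
      case 2
      have "{?v, New n i k (\<not> b)} = base_edge (i, k)" by (cases b) (auto simp: base_edge_def)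
      moreover have "j = new_vertex ((i, k), \<not> b)" using 2 by (simp add: new_vertex_def)
      ultimately show ?thesis using 2 ik by (auto simp: verts_step edges_step new_edges_def)
    qed
  qed
  then show ?thesis
    using notin ne by (simp add: strength_def x new_vertex_def weight_step)
qed

text \<open>With S the old total, old vertices contribute (\<delta> + 2) S. There are S/2 copies,
  each with two vertices of strength 2, which contribute another 2 S.\<close>

lemma sum_strength_step:
  "(\<Sum>i\<in>verts G'. strength G' i) = (\<delta> + 4) * (\<Sum>i\<in>verts G. strength G i)"
proof -
  have "(\<Sum>i\<in>verts G'. strength G' i) = (\<Sum>i\<in>verts G. strength G' i)
      + (\<Sum>i\<in>new_vertex ` (copies \<times> UNIV). strength G' i)"
    unfolding verts_step using finite_verts finite_copies new_vertex_disjoint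
    by (intro sum.union_disjoint) auto
  also have "(\<Sum>i\<in>verts G. strength G' i) = (\<delta> + 2) * (\<Sum>i\<in>verts G. strength G i)"
    by (simp add: strength_step_old sum_distrib_left)
  also have "(\<Sum>i\<in>new_vertex ` (copies \<times> UNIV). strength G' i) = 2 * (2 * card copies)"
    by (simp add: sum.reindex[OF inj_new_vertex] strength_step_new card_cartesian_product)
  finally show ?thesis unfolding card_copies by (simp add: algebra_simps)
qed

lemma card_edges_step:
  "2 * card (edges G') = 2 * card (edges G) + 3 * (\<Sum>i\<in>verts G. strength G i)"
proof -
  have "card (edges G') = card (edges G) + card new_edges"
    unfolding edges_step using finite_edges finite_new_edges new_edge_notin
    by (intro card_Un_disjoint) auto
  then show ?thesis using card_new_edges by simp
qed

lemma stage_bounded_step: "stage_bounded_graph G' (Suc n)"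
proof
  show "finite (verts G')"
    using finite_verts finite_copies by (simp add: verts_step)
  show "e \<subseteq> verts G'" if "e \<in> edges G'" for e
  proof -
    from that consider "e \<in> edges G" | x where "x \<in> copies" "e = base_edge x"
      | x where "x \<in> copies \<times> UNIV" "e = spoke x"
      by (auto simp: edges_step new_edges_def)
    then show ?thesis
    proof cases
      case 1
      then show ?thesis using edge_subset by (auto simp: verts_step)
    next
      case 2
      then have "e = new_vertex ` ({x} \<times> UNIV)"
        by (auto simp: base_edge_def new_vertex_def UNIV_bool split: prod.splits)
      then show ?thesis using 2 by (auto simp: verts_step)
    next
      case 3
      then have "e = {fst (fst x), new_vertex x}" "fst (fst x) \<in> verts G"
        by (auto simp: spoke_def new_vertex_def copies_def)
      then show ?thesis using 3 by (simp add: verts_step)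
    qed
  qed
  show "stage v < Suc n" if "v \<in> verts G'" for v
    using that stage_less by (auto simp: verts_step new_vertex_def intro: less_SucI)
  show "even (strength G' v)" if "v \<in> verts G'" for v
    using that even_strength by (auto simp: verts_step strength_step_old strength_step_new)
qed

text \<open>Positive total strength ensures that some edge is actually added, so that the weight 1
  is attained.\<close>

lemma weight_image_step:
  assumes "(\<Sum>i\<in>verts G. strength G i) > 0"
  shows "weight G' ` edges G' = insert 1 ((*) (1 + \<delta>) ` weight G ` edges G)"
proof -
  have "new_edges \<noteq> {}"
    using card_new_edges assms by (metis card.empty mult_is_0 not_gr0 zero_neq_numeral)
  then have "weight G' ` new_edges = {1}"
    using new_edge_notin by (auto simp: weight_step)
  moreover have "weight G' ` edges G = (*) (1 + \<delta>) ` weight G ` edges G"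
    by (auto simp: weight_step image_iff)
  ultimately show ?thesis by (simp add: edges_step image_Un)
qed

text \<open>A threshold above 1 rules out all new edges, and on old edges the common factor
  \<open>1 + \<delta>\<close> cancels.\<close>

lemma heavy_edges_step:
  assumes "(1 + \<delta>) * x > 1"
  shows "{e \<in> edges G'. (1 + \<delta>) * x \<le> weight G' e} = {e \<in> edges G. x \<le> weight G e}"
proof -
  define c where "c = 1 + \<delta>"
  have "c > 0" "c * x > 1" using assms by (simp_all add: c_def)
  then have "(e \<in> edges G' \<and> c * x \<le> weight G' e) = (e \<in> edges G \<and> x \<le> weight G e)" for e
    by (cases "e \<in> edges G") (simp_all add: edges_step weight_step[folded c_def])
  then show ?thesis unfolding c_def by (rule Collect_cong)
qed

end

section \<open>Total strength, edge counts and attained weights of the graphs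
  \<open>W \<delta> n\<close>\<close>

lemma strength_W_0:
  assumes "c \<in> {0, 1, 2}"
  shows "strength (W \<delta> 0) (Corner c) = 2"
proof -
  let ?N = "\<lambda>c. {j \<in> verts (W \<delta> 0). {Corner c, j} \<in> edges (W \<delta> 0)}"
  have "{Corner 0, j} \<in> edges (W \<delta> 0) \<longleftrightarrow> j = Corner 1 \<or> j = Corner 2"
    and "{Corner 1, j} \<in> edges (W \<delta> 0) \<longleftrightarrow> j = Corner 0 \<or> j = Corner 2"
    and "{Corner 2, j} \<in> edges (W \<delta> 0) \<longleftrightarrow> j = Corner 0 \<or> j = Corner 1" for j
    by (simp_all add: doubleton_eq_iff disj_commute)
  then have "?N 0 = {Corner 1, Corner 2}" "?N 1 = {Corner 0, Corner 2}" "?N 2 = {Corner 0, Corner 1}"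
    by (simp_all only: W.simps wgraph.select_convs) blast+
  then have "card (?N c) = 2" using assms by (elim insertE emptyE) simp_all
  moreover have "strength (W \<delta> 0) (Corner c) = card (?N c)"
    by (simp add: strength_def)
  ultimately show ?thesis by simp
qed

lemma stage_bounded_W: "stage_bounded_graph (W \<delta> n) (Suc n)"
proof (induction n)
  case 0
  show ?case
  proof
    show "finite (verts (W \<delta> 0))" by simp
    show "e \<subseteq> verts (W \<delta> 0)" if "e \<in> edges (W \<delta> 0)" for e using that by auto
    show "stage v < Suc 0" if "v \<in> verts (W \<delta> 0)" for v using that by auto
    show "even (strength (W \<delta> 0) v)" if "v \<in> verts (W \<delta> 0)" for v
    proof -
      from that obtain c where "v = Corner c" "c \<in> {0, 1, 2}" by auto
      then show ?thesis by (simp only: strength_W_0 even_numeral)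
    qed
  qed
next
  case (Suc n)
  interpret stage_bounded_graph "W \<delta> n" "Suc n" \<delta> by (fact Suc)
  show ?case using stage_bounded_step by simp
qed

lemma sum_strength_W: "(\<Sum>i\<in>verts (W \<delta> n). strength (W \<delta> n) i) = 6 * (\<delta> + 4) ^ n"
proof (induction n)
  case 0
  have "(\<Sum>i\<in>Corner ` {0, 1, 2}. strength (W \<delta> 0) i) = 6"
    by (simp add: strength_W_0 del: W.simps)
  then show ?case by simp
next
  case (Suc n)
  interpret stage_bounded_graph "W \<delta> n" "Suc n" \<delta> by (fact stage_bounded_W)
  show ?case using sum_strength_step Suc by simp
qed

lemma card_edges_W_0: "card (edges (W \<delta> 0)) = 3"
  by (simp add: doubleton_eq_iff)

text \<open>The 9 is 3/2, the number of new edges per unit of strength, times the 6 in the total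
  strength.\<close>

lemma card_edges_W_Suc: "card (edges (W \<delta> (Suc n))) = card (edges (W \<delta> n)) + 9 * (\<delta> + 4) ^ n"
proof -
  interpret stage_bounded_graph "W \<delta> n" "Suc n" \<delta> by (fact stage_bounded_W)
  show ?thesis using card_edges_step sum_strength_W[of \<delta> n] by simp
qed

lemma finite_edges_W: "finite (edges (W \<delta> n))"
  using stage_bounded_W by (rule stage_bounded_graph.finite_edges)

lemma card_edges_W_upper: "card (edges (W \<delta> n)) \<le> 3 * (\<delta> + 4) ^ n"
proof (induction n)
  case (Suc n)
  \<comment> \<open>At most 3 times the power from the induction hypothesis plus 9 times it from the
    new edges make 12, and 12 \<le> 3 (\<delta> + 4).\<close>
  have "12 * (\<delta> + 4) ^ n \<le> (3 * (\<delta> + 4)) * (\<delta> + 4) ^ n"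
    by (intro mult_right_mono) auto
  then show ?case
    using Suc unfolding card_edges_W_Suc power_Suc mult.assoc by linarith
qed (simp add: card_edges_W_0 del: W.simps)

text \<open>The edges created in the last step alone suffice; their number involves the power n - 1,
  hence the extra factor \<open>\<delta> + 4\<close> on the right.\<close>

lemma card_edges_W_lower: "3 * (\<delta> + 4) ^ n \<le> (\<delta> + 4) * card (edges (W \<delta> n))"
proof (cases n)
  case (Suc m)
  have "3 * (\<delta> + 4) ^ m \<le> card (edges (W \<delta> (Suc m)))"
    unfolding card_edges_W_Suc by simp
  then have "(\<delta> + 4) * (3 * (\<delta> + 4) ^ m) \<le> (\<delta> + 4) * card (edges (W \<delta> (Suc m)))"
    by (rule mult_left_mono) simp
  then show ?thesis by (simp add: Suc mult.left_commute del: W.simps)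
qed (simp add: card_edges_W_0 del: W.simps)

lemma weight_image_W: "weight (W \<delta> n) ` edges (W \<delta> n) = (\<lambda>k. (1 + \<delta>) ^ k) ` {..n}"
proof (induction n)
  case 0
  show ?case by simp
next
  case (Suc n)
  interpret stage_bounded_graph "W \<delta> n" "Suc n" \<delta> by (fact stage_bounded_W)
  show ?case
    using weight_image_step Suc
    by (simp add: sum_strength_W image_image atMost_Suc_eq_insert_0 del: Suc.IH)
qed

text \<open>Each use of \<open>heavy_edges_step\<close> lowers the exponent of the threshold and the
  index of the graph by one. After k rounds the threshold is 1, which every edge of the remaining
  graph meets. Positivity of \<open>\<delta>\<close> keeps the earlier thresholds above 1.\<close>

lemma card_heavy_edges_W:
  assumes "\<delta> > 0" "k \<le> n"
  shows "card {e \<in> edges (W \<delta> n). (1 + \<delta>) ^ k \<le> weight (W \<delta> n) e} = card (edges (W \<delta> (n - k)))"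
  using assms(2)
proof (induction k arbitrary: n)
  case 0
  have "1 \<le> weight (W \<delta> n) e" if "e \<in> edges (W \<delta> n)" for e
  proof -
    have "weight (W \<delta> n) e \<in> (\<lambda>k. (1 + \<delta>) ^ k) ` {..n}"
      unfolding weight_image_W[symmetric] using that by (rule imageI)
    then show ?thesis by auto
  qed
  then have "{e \<in> edges (W \<delta> n). 1 \<le> weight (W \<delta> n) e} = edges (W \<delta> n)"
    by blast
  then show ?case by simp
next
  case (Suc k)
  then obtain m where n: "n = Suc m" and "k \<le> m" by (cases n) auto
  interpret stage_bounded_graph "W \<delta> m" "Suc m" \<delta> by (fact stage_bounded_W)
  have "1 < (1 + \<delta>) ^ Suc k" using assms(1) by (intro one_less_power) auto
  then have "1 < (1 + \<delta>) * (1 + \<delta>) ^ k" by (simp only: power_Suc)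
  then show ?case
    using Suc.IH[OF \<open>k \<le> m\<close>]
    by (simp only: n W.simps power_Suc heavy_edges_step diff_Suc_Suc)
qed

lemma edges_W_nonempty: "edges (W \<delta> n) \<noteq> {}"
  using weight_image_W[of \<delta> n] by auto

lemma card_edges_W_bounds:
  shows "3 * (real \<delta> + 4) ^ n / (real \<delta> + 4) \<le> real (card (edges (W \<delta> n)))"
    and "real (card (edges (W \<delta> n))) \<le> 3 * (real \<delta> + 4) ^ n"
proof -
  have "real (3 * (\<delta> + 4) ^ n) \<le> real ((\<delta> + 4) * card (edges (W \<delta> n)))"
    using card_edges_W_lower by (rule of_nat_mono)
  then show "3 * (real \<delta> + 4) ^ n / (real \<delta> + 4) \<le> real (card (edges (W \<delta> n)))"
    by (simp add: field_simps)
  have "real (card (edges (W \<delta> n))) \<le> real (3 * (\<delta> + 4) ^ n)"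
    using card_edges_W_upper by (rule of_nat_mono)
  then show "real (card (edges (W \<delta> n))) \<le> 3 * (real \<delta> + 4) ^ n"
    by (simp add: add.commute)
qed

text \<open>The upper and lower bounds on the edge count differ by the factor q, so each side of the
  ratio loses one q, uniformly in n and k.\<close>

lemma card_edges_W_ratio_bounds:
  fixes \<delta> :: nat
  assumes "k \<le> n"
  defines "q \<equiv> real \<delta> + 4"
  defines "r \<equiv> real (card (edges (W \<delta> (n - k)))) / real (card (edges (W \<delta> n)))"
  shows "1 / (q * q ^ k) \<le> r" and "r \<le> q / q ^ k"
proof -
  have q: "q > 0" by (simp add: q_def)
  have split: "q ^ n = q ^ (n - k) * q ^ k"
    using assms(1) by (simp flip: power_add)
  note lo = card_edges_W_bounds(1)[of \<delta>, folded q_def]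
  note hi = card_edges_W_bounds(2)[of \<delta>, folded q_def]
  have "(3 * q ^ (n - k) / q) / (3 * q ^ n) \<le> r"
    unfolding r_def using q lo[of "n - k"] hi[of n] edges_W_nonempty finite_edges_W
    by (intro frac_le) (auto simp: card_gt_0_iff)
  then show "1 / (q * q ^ k) \<le> r"
    using q by (simp add: split)
  have "r \<le> (3 * q ^ (n - k)) / (3 * q ^ n / q)"
    unfolding r_def using q lo[of n] hi[of "n - k"]
    by (intro frac_le) auto
  then show "r \<le> q / q ^ k"
    using q by (simp add: split)
qed

section \<open>The weight distribution of \<open>W \<delta> n\<close>: support, tails and point
  masses\<close>

lemma set_pmf_weight_pmf:
  assumes "finite (edges G)" "edges G \<noteq> {}"
  shows "set_pmf (weight_pmf G) = real ` weight G ` edges G"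
  using assms by (simp add: weight_pmf_def image_image)

lemma prob_weight_pmf:
  assumes "finite (edges G)" "edges G \<noteq> {}"
  shows "measure_pmf.prob (weight_pmf G) A = card {e \<in> edges G. real (weight G e) \<in> A} / card (edges G)"
proof -
  have "edges G \<inter> (\<lambda>e. real (weight G e)) -` A = {e \<in> edges G. real (weight G e) \<in> A}"
    by auto
  then show ?thesis
    using assms by (simp add: weight_pmf_def measure_pmf_of_set)
qed

lemma set_pmf_weight_pmf_W:
  "set_pmf (weight_pmf (W \<delta> n)) = (\<lambda>k. (real \<delta> + 1) ^ k) ` {..n}"
proof -
  have "set_pmf (weight_pmf (W \<delta> n)) = real ` (\<lambda>k. (1 + \<delta>) ^ k) ` {..n}"
    unfolding set_pmf_weight_pmf[OF finite_edges_W edges_W_nonempty] weight_image_W ..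
  then show ?thesis by (simp add: image_image add.commute)
qed

lemma Max_weight_pmf_W: "Max (set_pmf (weight_pmf (W \<delta> n))) = (real \<delta> + 1) ^ n"
  unfolding set_pmf_weight_pmf_W
  by (intro Max_eqI) (auto intro: power_increasing)

lemma Min_weight_pmf_W: "Min (set_pmf (weight_pmf (W \<delta> n))) = 1"
  unfolding set_pmf_weight_pmf_W
  by (intro Min_eqI) (auto intro!: image_eqI[of _ _ 0])

text \<open>The strict bound \<open>k < n\<close> ensures that the next power is itself an attained
  weight.\<close>

lemma next_weight_W:
  assumes "\<delta> > 0" "k < n"
  shows "Min {v \<in> set_pmf (weight_pmf (W \<delta> n)). (real \<delta> + 1) ^ k < v} = (real \<delta> + 1) ^ Suc k"
proof (rule Min_eqI)
  have a: "real \<delta> + 1 > 1" using assms(1) by simp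
  show "finite {v \<in> set_pmf (weight_pmf (W \<delta> n)). (real \<delta> + 1) ^ k < v}"
    by (simp add: set_pmf_weight_pmf_W)
  show "(real \<delta> + 1) ^ Suc k \<le> v"
    if "v \<in> {v \<in> set_pmf (weight_pmf (W \<delta> n)). (real \<delta> + 1) ^ k < v}" for v
  proof -
    from that obtain j where v: "v = (real \<delta> + 1) ^ j" and "(real \<delta> + 1) ^ k < (real \<delta> + 1) ^ j"
      by (auto simp: set_pmf_weight_pmf_W)
    then have "k < j" using a by (simp only: power_strict_increasing_iff)
    then show ?thesis unfolding v using a by (intro power_increasing) auto
  qed
  show "(real \<delta> + 1) ^ Suc k \<in> {v \<in> set_pmf (weight_pmf (W \<delta> n)). (real \<delta> + 1) ^ k < v}"
    using assms a power_strict_increasing[of k "Suc k" "real \<delta> + 1"]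
    by (auto simp: set_pmf_weight_pmf_W intro!: image_eqI[of _ _ "Suc k"] simp del: power_Suc)
qed

lemma cumulative_weight_pmf_W:
  assumes "\<delta> > 0" "k \<le> n"
  shows "cumulative (weight_pmf (W \<delta> n)) ((real \<delta> + 1) ^ k)
    = real (card (edges (W \<delta> (n - k)))) / real (card (edges (W \<delta> n)))"
proof -
  have "(real \<delta> + 1) ^ k \<le> real m \<longleftrightarrow> (1 + \<delta>) ^ k \<le> m" for m
  proof -
    have "(real \<delta> + 1) ^ k = real ((1 + \<delta>) ^ k)" by (simp add: add.commute)
    then show ?thesis by (simp only: of_nat_le_iff)
  qed
  then show ?thesis
    unfolding cumulative_def prob_weight_pmf[OF finite_edges_W edges_W_nonempty]
    by (simp only: atLeast_iff card_heavy_edges_W[OF assms])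
qed

text \<open>A tail depends on its threshold only through the support points it contains. This allows
  an arbitrary real threshold to be replaced by an attained weight.\<close>

lemma cumulative_eqI:
  assumes "\<And>x. x \<in> set_pmf p \<Longrightarrow> v \<le> x \<longleftrightarrow> w \<le> x"
  shows "cumulative p v = cumulative p w"
proof -
  have "{v..} \<inter> set_pmf p = {w..} \<inter> set_pmf p" using assms by auto
  then show ?thesis unfolding cumulative_def by (metis measure_Int_set_pmf)
qed

text \<open>A point mass is the difference of two consecutive tails, and the numerators of these
  differ by the edges created in step n - k. For k = n these would be the three initial edges, to
  which the formula does not apply.\<close>

lemma pmf_weight_pmf_W:
  assumes "\<delta> > 0" "k < n"
  shows "pmf (weight_pmf (W \<delta> n)) ((real \<delta> + 1) ^ k)
    = 9 * (real \<delta> + 4) ^ (n - Suc k) / real (card (edges (W \<delta> n)))"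
proof -
  let ?p = "weight_pmf (W \<delta> n)" and ?a = "real \<delta> + 1"
  have a: "?a > 1" using assms(1) by simp
  have "pmf ?p (?a ^ k) = measure_pmf.prob ?p ({?a ^ k} \<inter> set_pmf ?p)"
    by (simp add: measure_Int_set_pmf measure_pmf_single)
  \<comment> \<open>No power of \<open>?a\<close> lies strictly between two consecutive ones, so
    within the support the half-open interval contains only its left end.\<close>
  also have "{?a ^ k} \<inter> set_pmf ?p = ({?a ^ k..} - {?a ^ Suc k..}) \<inter> set_pmf ?p"
  proof -
    have "j = k" if "?a ^ k \<le> ?a ^ j" "\<not> ?a ^ Suc k \<le> ?a ^ j" for j
      using that unfolding power_increasing_iff[OF a] by simp
    moreover have "?a ^ k < ?a ^ Suc k" using a by (intro power_strict_increasing) auto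
    ultimately show ?thesis by (auto simp: set_pmf_weight_pmf_W simp del: power_Suc)
  qed
  also have "measure_pmf.prob ?p \<dots> = measure_pmf.prob ?p ({?a ^ k..} - {?a ^ Suc k..})"
    by (rule measure_Int_set_pmf)
  also have "\<dots> = cumulative ?p (?a ^ k) - cumulative ?p (?a ^ Suc k)"
    unfolding cumulative_def using a
    by (intro measure_pmf.finite_measure_Diff) (auto intro: order_trans[OF power_increasing])
  also have "\<dots> = (real (card (edges (W \<delta> (n - k)))) - real (card (edges (W \<delta> (n - Suc k)))))
      / real (card (edges (W \<delta> n)))"
    using assms by (simp only: cumulative_weight_pmf_W less_imp_le Suc_leI diff_divide_distrib)
  also have "n - k = Suc (n - Suc k)" using assms(2) by simp
  finally show ?thesis by (simp add: card_edges_W_Suc add.commute del: W.simps)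
qed

lemma pmf_weight_pmf_W_bounds:
  fixes \<delta> :: nat
  assumes "\<delta> > 0" "k < n"
  defines "q \<equiv> real \<delta> + 4"
  defines "r \<equiv> pmf (weight_pmf (W \<delta> n)) ((real \<delta> + 1) ^ k)"
  shows "3 / (q * q ^ k) \<le> r" and "r \<le> 3 / q ^ k"
proof -
  have q: "q > 0" by (simp add: q_def)
  have split: "q ^ n = q ^ (n - Suc k) * (q * q ^ k)"
    using assms(2) by (simp flip: power_add power_Suc)
  note lo = card_edges_W_bounds(1)[of \<delta>, folded q_def]
  note hi = card_edges_W_bounds(2)[of \<delta>, folded q_def]
  note r = pmf_weight_pmf_W[OF assms(1,2), folded q_def r_def]
  have "(9 * q ^ (n - Suc k)) / (3 * q ^ n) \<le> r"
    unfolding r using q hi[of n] edges_W_nonempty finite_edges_W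
    by (intro frac_le) (auto simp: card_gt_0_iff)
  then show "3 / (q * q ^ k) \<le> r"
    using q by (simp add: split)
  have "r \<le> (9 * q ^ (n - Suc k)) / (3 * q ^ n / q)"
    unfolding r using q lo[of n] by (intro frac_le) auto
  then show "r \<le> 3 / q ^ k"
    using q by (simp add: split)
qed

section \<open>Passage from powers of \<delta> + 4 to powers of the weight, and the power
  law\<close>

lemma power_powr_ln_ratio:
  fixes a q :: real
  assumes "a > 1" "q > 0"
  shows "(a ^ k) powr (ln q / ln a) = q ^ k"
proof -
  have "(a ^ k) powr (ln q / ln a) = exp (real k * ln q)"
    using assms by (simp add: powr_def ln_realpow)
  also have "\<dots> = q ^ k"
    using assms by (simp add: exp_of_nat_mult)
  finally show ?thesis .
qed

text \<open>Over a principal filter "eventually" means "everywhere on the set", so explicit uniform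
  constants are what has to be supplied.\<close>

lemma bigtheta_principal_pairI:
  fixes f g :: "'a \<Rightarrow> 'b \<Rightarrow> real"
  assumes "c1 > 0" "c2 > 0"
    and "\<And>x y. P x y \<Longrightarrow> c1 * norm (g x y) \<le> norm (f x y) \<and> norm (f x y) \<le> c2 * norm (g x y)"
  shows "(\<lambda>(x, y). f x y) \<in> \<Theta>[principal {(x, y). P x y}](\<lambda>(x, y). g x y)"
  using assms(1,2)
  by (rule bigthetaI') (use assms(3) in \<open>auto simp: eventually_principal\<close>)

theorem proposition3p3:
  fixes \<delta> :: nat
  assumes "\<delta> > 0"
  shows "power_law (\<lambda>n. weight_pmf (W \<delta> n)) (1 + ln (real \<delta> + 4) / ln (real \<delta> + 1))"
proof -
  define a q \<alpha> where "a = real \<delta> + 1" and "q = real \<delta> + 4" and "\<alpha> = ln q / ln a"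
  let ?p = "\<lambda>n. weight_pmf (W \<delta> n)"
  have a: "a > 1" and q: "q > 1" using assms by (auto simp: a_def q_def)
  have \<alpha>: "\<alpha> > 0" using a q by (simp add: \<alpha>_def)
  \<comment> \<open>The exponent \<open>\<alpha>\<close> is the solution of
    \<open>a powr \<alpha> = q\<close>: it converts the growth of weights per step into the growth
    of edge counts.\<close>
  have powr_\<alpha>: "(a ^ k) powr \<alpha> = q ^ k" for k
    unfolding \<alpha>_def using a q by (intro power_powr_ln_ratio) auto
  note set_p = set_pmf_weight_pmf_W[of \<delta>, folded a_def]
  note Max_p = Max_weight_pmf_W[of \<delta>, folded a_def]
  note Min_p = Min_weight_pmf_W[of \<delta>]
  have "filterlim (\<lambda>n. Max (set_pmf (?p n))) at_top sequentially"
    unfolding Max_p using a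
    by (intro filterlim_at_infinity_imp_filterlim_at_top filterlim_realpow_sequentially_gt1) auto
  moreover have "(\<lambda>(n, w). prob_density (?p n) w)
      \<in> \<Theta>[principal {(n, w). w \<in> set_pmf (?p n) \<and> w < Max (set_pmf (?p n))}](\<lambda>(n, w). w powr - (1 + \<alpha>))"
  \<comment> \<open>The constants 3/q and 3 bound the point mass relative to
    \<open>1 / q ^ k\<close>; the \<delta> comes from the gap \<open>\<delta> * a ^ k\<close> to the
    next weight.\<close>
  proof (rule bigtheta_principal_pairI[of "3 / (q * \<delta>)" "3 / \<delta>"])
    show "3 / (q * \<delta>) * norm (w powr - (1 + \<alpha>)) \<le> norm (prob_density (?p n) w) \<and>
        norm (prob_density (?p n) w) \<le> 3 / \<delta> * norm (w powr - (1 + \<alpha>))"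
      if "w \<in> set_pmf (?p n) \<and> w < Max (set_pmf (?p n))" for n w
    proof -
      from that obtain k where w: "w = a ^ k" and "a ^ k < a ^ n"
        unfolding Max_p by (auto simp: set_p)
      then have k: "k < n" using a by (simp only: power_strict_increasing_iff)
      have pos: "a ^ k > 0" "q ^ k > 0" using a q by simp_all
      have powr: "w powr - (1 + \<alpha>) = 1 / (a ^ k * q ^ k)"
        using pos unfolding powr_minus_divide powr_add w powr_\<alpha> by simp
      have "prob_density (?p n) w = pmf (?p n) (a ^ k) / (a ^ Suc k - a ^ k)"
        unfolding prob_density_def w a_def next_weight_W[OF assms k] ..
      also have "a ^ Suc k - a ^ k = \<delta> * a ^ k"
        by (simp add: a_def algebra_simps)
      finally have dens: "prob_density (?p n) w = pmf (?p n) (a ^ k) / (\<delta> * a ^ k)" .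
      have "3 / (q * q ^ k) / (\<delta> * a ^ k) \<le> prob_density (?p n) w"
        unfolding dens using pmf_weight_pmf_W_bounds(1)[OF assms k, folded a_def q_def] pos
        by (intro divide_right_mono) auto
      moreover have "prob_density (?p n) w \<le> 3 / q ^ k / (\<delta> * a ^ k)"
        unfolding dens using pmf_weight_pmf_W_bounds(2)[OF assms k, folded a_def q_def] pos
        by (intro divide_right_mono) auto
      moreover have "prob_density (?p n) w \<ge> 0" unfolding dens using pos by simp
      ultimately show ?thesis using pos unfolding powr by (simp add: mult_ac)
    qed
  qed (use assms q in auto)
  moreover have "(\<lambda>(n, w). cumulative (?p n) w)
      \<in> \<Theta>[principal {(n, w). Min (set_pmf (?p n)) \<le> w \<and> w \<le> Max (set_pmf (?p n))}](\<lambda>(n, w). w powr - \<alpha>)"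
  \<comment> \<open>One q on each side comes from the ratio of edge counts. Rounding
    \<open>w\<close> up to a power of \<open>a\<close> costs a second q, but only in the lower
    bound.\<close>
  proof (rule bigtheta_principal_pairI[of "1 / q\<^sup>2" q])
    show "1 / q\<^sup>2 * norm (w powr - \<alpha>) \<le> norm (cumulative (?p n) w) \<and>
        norm (cumulative (?p n) w) \<le> q * norm (w powr - \<alpha>)"
      if "Min (set_pmf (?p n)) \<le> w \<and> w \<le> Max (set_pmf (?p n))" for n w
    proof -
      have w: "1 \<le> w" "w \<le> a ^ n" using that by (simp_all add: Min_p Max_p)
      \<comment> \<open>Here \<open>w\<close> is any real between the extreme weights, not
        necessarily attained. By minimality every smaller power is below \<open>w\<close>, so no
        weight is lost in rounding up to \<open>a ^ k\<close> and the tail is unchanged.\<close>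
      define k where "k = (LEAST k. w \<le> a ^ k)"
      have k: "w \<le> a ^ k" "k \<le> n"
        unfolding k_def using w(2) by (rule LeastI, rule Least_le)
      have less_k: "a ^ j < w" if "j < k" for j
        using that not_less_Least unfolding k_def by fastforce
      have pos: "q ^ k > 0" using q by simp
      have "cumulative (?p n) w = cumulative (?p n) (a ^ k)"
      proof (rule cumulative_eqI)
        fix x assume "x \<in> set_pmf (?p n)"
        then obtain j where x: "x = a ^ j" by (auto simp: set_p)
        show "w \<le> x \<longleftrightarrow> a ^ k \<le> x"
          using k(1) less_k[of j] a unfolding x by (metis power_increasing_iff not_le order_trans)
      qed
      also have "\<dots> = real (card (edges (W \<delta> (n - k)))) / real (card (edges (W \<delta> n)))"
        unfolding a_def using assms k(2) by (rule cumulative_weight_pmf_W)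
      finally have cum: "1 / (q * q ^ k) \<le> cumulative (?p n) w" "cumulative (?p n) w \<le> q / q ^ k"
        using card_edges_W_ratio_bounds[OF k(2), of \<delta>] by (simp_all add: q_def)
      have "w powr \<alpha> \<le> (a ^ k) powr \<alpha>"
        using w k(1) \<alpha> by (intro powr_mono2) auto
      then have up: "w powr \<alpha> \<le> q ^ k" by (simp add: powr_\<alpha>)
      \<comment> \<open>The rounding loses at most one factor \<open>a\<close>, which becomes q
        under the power \<open>\<alpha>\<close>. For k = 0 there is no preceding power, and
        \<open>1 \<le> w\<close> takes its place.\<close>
      have low: "q ^ k \<le> q * w powr \<alpha>"
      proof (cases k)
        case 0
        have "1 powr \<alpha> \<le> w powr \<alpha>" using w \<alpha> by (intro powr_mono2) auto
        then have "1 * 1 \<le> q * w powr \<alpha>" using q by (intro mult_mono) auto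
        then show ?thesis by (simp add: 0)
      next
        case (Suc j)
        have "(a ^ j) powr \<alpha> \<le> w powr \<alpha>"
          using less_k[of j] a \<alpha> Suc by (intro powr_mono2) auto
        then show ?thesis using q by (simp add: powr_\<alpha> Suc)
      qed
      have wpos: "w powr \<alpha> > 0" using w by simp
      have "1 / q\<^sup>2 * w powr - \<alpha> = 1 / (q * (q * w powr \<alpha>))"
        by (simp add: powr_minus_divide power2_eq_square)
      also have "\<dots> \<le> 1 / (q * q ^ k)"
        using low pos q w(1) by (intro divide_left_mono mult_left_mono mult_pos_pos) auto
      also have "\<dots> \<le> cumulative (?p n) w" by (fact cum)
      finally have 1: "1 / q\<^sup>2 * w powr - \<alpha> \<le> cumulative (?p n) w" .
      have "cumulative (?p n) w \<le> q / q ^ k" by (fact cum)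
      also have "\<dots> \<le> q / w powr \<alpha>"
        using up wpos q by (intro divide_left_mono) auto
      finally have 2: "cumulative (?p n) w \<le> q * w powr - \<alpha>"
        by (simp add: powr_minus_divide)
      show ?thesis using 1 2 by (simp add: cumulative_def)
    qed
  qed (use q in auto)
  ultimately show ?thesis
    unfolding power_law_def a_def q_def \<alpha>_def by simp
qed

end
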